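(* Let $X$ be a real Banach space with a normalized subsymmetric basis $(\varphi_i)_{i\ge1}$ whose subsymmetric constant is $1$. Then for every $n=1,2,\ldots$ $$\varrho^{(n)}\ge\max\left\{\frac{n+2}{6}\,\lambda(2^n),\ 2^n\right\}.$$
   Context: A (Schauder) basis $(\varphi_i)$ of a Banach space $X$ is normalized if $\|\varphi_i\|=1$ for all $i$. It is unconditional if $(\varphi_{\pi(i)})$ is a basis of $X$ for every permutation $\pi$ of $\mathbb{N}$. Two bases $(\varphi_i)$, $(\psi_i)$ are equivalent if $\sum\alpha_i\varphi_i$ converges if and only if $\sum\alpha_i\psi_i$ converges. A basis is subsymmetric if it is unconditional and $(\varphi_{i_n})$ is equivalent to $(\varphi_i)$ for every increasing sequence of positive integers $(i_n)$. Its subsymmetric constant is the smallest $K$ such that $\|\sum_{n}\vartheta_n\alpha_n\varphi_{i_n}\|\le K\|\sum_{i}\alpha_i\varphi_i\|$ for all scalars $(\alpha_i)$ for which $\sum_i\alpha_i\varphi_i$ converges, all signs $\vartheta_n\in\{-1,1\}$ and all increasing sequences of positive integers $(i_n)$. $\lambda(n)=\left\|\sum_{i=1}^n\varphi_i\right\|$. The Sylvester matrices $\mathcal S^{(n)}=[s^{(n)}_{ki}]$ (of order $2^n$; $k$ is the row index and $i$ the column index) are defined by $\mathcal S^{(1)}=\begin{bmatrix}1&1\\1&-1\end{bmatrix}$ and $\mathcal S^{(n)}=\begin{bmatrix}\mathcal S^{(n-1)}&\mathcal S^{(n-1)}\\ \mathcal S^{(n-1)}&-\mathcal S^{(n-1)}\end{bmatrix}$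 for $n\ge2$. $\varrho^{(n)}=\max_{1\le m\le 2^n}\left\|\sum_{i=1}^{2^n}\left(\sum_{k=1}^m s_{ki}^{(n)}\right)\varphi_i\right\|$. *)

theory Defs
  imports Complex_Main "Jordan_Normal_Form.Matrix"
begin

text \<open>All sequences, and the rows and columns of matrices, are indexed from 0, so that
  \<open>\<phi> i\<close> is the basis vector written $\varphi_{i+1}$ in one-based notation. Real Banach spaces are
  types of class \<open>banach\<close>.\<close>

definition schauder_basis :: "(nat \<Rightarrow> 'a::banach) \<Rightarrow> bool" where
  "schauder_basis \<phi> \<longleftrightarrow> (\<forall>x. \<exists>!\<alpha>::nat \<Rightarrow> real. (\<lambda>i. \<alpha> i *\<^sub>R \<phi> i) sums x)"

definition normalized :: "(nat \<Rightarrow> 'a::banach) \<Rightarrow> bool" where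
  "normalized \<phi> \<longleftrightarrow> (\<forall>i. norm (\<phi> i) = 1)"

definition unconditional_basis :: "(nat \<Rightarrow> 'a::banach) \<Rightarrow> bool" where
  "unconditional_basis \<phi> \<longleftrightarrow>
     schauder_basis \<phi> \<and> (\<forall>\<pi>. bij \<pi> \<longrightarrow> schauder_basis (\<lambda>i. \<phi> (\<pi> i)))"

text \<open>Equivalence is stated for arbitrary sequences: a subsequence of a basis is in general a basis
  only of its own closed linear span, not of the whole space.\<close>

definition equivalent_seqs :: "(nat \<Rightarrow> 'a::banach) \<Rightarrow> (nat \<Rightarrow> 'b::banach) \<Rightarrow> bool" where
  "equivalent_seqs \<phi> \<psi> \<longleftrightarrow>
     (\<forall>\<alpha>::nat \<Rightarrow> real. summable (\<lambda>i. \<alpha> i *\<^sub>R \<phi> i) \<longleftrightarrow> summable (\<lambda>i. \<alpha> i *\<^sub>R \<psi> i))"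

definition subsymmetric_basis :: "(nat \<Rightarrow> 'a::banach) \<Rightarrow> bool" where
  "subsymmetric_basis \<phi> \<longleftrightarrow>
     unconditional_basis \<phi> \<and>
     (\<forall>\<iota>::nat \<Rightarrow> nat. strict_mono \<iota> \<longrightarrow> equivalent_seqs (\<lambda>n. \<phi> (\<iota> n)) \<phi>)"

text \<open>For a subsymmetric basis the series on the left-hand side below always converges, so its
  \<open>suminf\<close> is the genuine sum.\<close>

definition subsymmetric_bound :: "(nat \<Rightarrow> 'a::banach) \<Rightarrow> real \<Rightarrow> bool" where
  "subsymmetric_bound \<phi> K \<longleftrightarrow>
     (\<forall>(\<alpha>::nat \<Rightarrow> real) (\<theta>::nat \<Rightarrow> real) (\<iota>::nat \<Rightarrow> nat).
        summable (\<lambda>i. \<alpha> i *\<^sub>R \<phi> i) \<longrightarrow> (\<forall>n. \<theta> n \<in> {-1, 1}) \<longrightarrow> strict_mono \<iota> \<longrightarrow>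
        norm (\<Sum>n. (\<theta> n * \<alpha> n) *\<^sub>R \<phi> (\<iota> n)) \<le> K * norm (\<Sum>i. \<alpha> i *\<^sub>R \<phi> i))"

text \<open>The constant is given as a relation (being the least bound) rather than as a value of
  \<open>Least\<close> or \<open>Inf\<close>, which would be unspecified if no bound existed.\<close>

definition is_subsymmetric_constant :: "(nat \<Rightarrow> 'a::banach) \<Rightarrow> real \<Rightarrow> bool" where
  "is_subsymmetric_constant \<phi> K \<longleftrightarrow>
     subsymmetric_bound \<phi> K \<and> (\<forall>K'. subsymmetric_bound \<phi> K' \<longrightarrow> K \<le> K')"

definition fundamental_fun :: "(nat \<Rightarrow> 'a::banach) \<Rightarrow> nat \<Rightarrow> real" where
  "fundamental_fun \<phi> n = norm (\<Sum>i<n. \<phi> i)"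

text \<open>The matrices are defined for \<open>n \<ge> 1\<close>; the value at \<open>0\<close> only makes the function total.\<close>

fun sylvester :: "nat \<Rightarrow> real mat" where
  "sylvester 0 = 1\<^sub>m 1"
| "sylvester (Suc 0) = mat_of_rows_list 2 [[1, 1], [1, -1]]"
| "sylvester (Suc (Suc n)) =
     four_block_mat (sylvester (Suc n)) (sylvester (Suc n))
                    (sylvester (Suc n)) (- sylvester (Suc n))"

lemma sylvester_carrier: "sylvester n \<in> carrier_mat (2 ^ n) (2 ^ n)"
proof (induction n rule: sylvester.induct)
  case 2
  show ?case by (simp add: mat_of_rows_list_def numeral_2_eq_2)
next
  case (3 n)
  then show ?case by (auto intro!: carrier_matI)
qed simp

definition sylvester_rho :: "(nat \<Rightarrow> 'a::banach) \<Rightarrow> nat \<Rightarrow> real" where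
  "sylvester_rho \<phi> n =
     Max ((\<lambda>m. norm (\<Sum>i<2^n. (\<Sum>k<m. sylvester n $$ (k, i)) *\<^sub>R \<phi> i)) ` {1..2^n})"

end

theory Submission
  imports Defs "HOL-Computational_Algebra.Primes"
begin

text \<open>
  Write \<open>N = 2 ^ n\<close> and let \<open>W i m\<close> be the sum of the first \<open>m\<close> entries of column \<open>i\<close>, so that
  \<open>\<rho>\<close> is the maximum over \<open>m\<close> of the norm of the vector with coordinates \<open>W i m\<close>. For \<open>m = N\<close>
  the coordinate \<open>W 0 N = N\<close> alone gives the bound \<open>2 ^ n\<close>. The other bound comes from a single
  \<open>m\<close> next to \<open>2 N / 3\<close>.

  If \<open>2 ^ t\<close> is the largest power of 2 dividing \<open>i > 0\<close>, then column \<open>i\<close> is made of blocks of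
  \<open>2 ^ t\<close> equal signs, grouped into consecutive pairs of opposite sign; hence \<open>\<bar>W i m\<bar>\<close> is the
  distance from \<open>m\<close> to a multiple of \<open>2 ^ (t + 1)\<close> (\<open>column_sum_distance\<close>). When
  \<open>3 m = 2 N \<plusminus> 1\<close>, the number \<open>m\<close> stays about \<open>1/3\<close> of a period away from all multiples
  of all these powers at once, so \<open>\<bar>W i m\<bar> \<ge> (2 * 2 ^ t - 1) / 3\<close>. Any window of
  \<open>2 ^ l\<close> consecutive positive indices contains \<open>2 ^ (l - t - 1)\<close> indices of each exact
  2-power \<open>t < l\<close>, and one index divisible by \<open>2 ^ l\<close>; each \<open>t\<close> contributes equally to the
  sum of \<open>2 ^ t\<close>, and the mean of \<open>\<bar>W i m\<bar>\<close> over the window is at least \<open>(l + 1) / 3\<close>.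

  To turn means into norms one averages the vector over translations of its coordinates. The
  inequality that defines the subsymmetric constant is one-sided: constant 1 makes signed
  translations to the right contractions, but moving coordinates to the left may increase the norm
  (for instance the norm \<open>max (sup \<bar>a i\<bar>) (\<bar>a 0\<bar> + \<bar>a 1\<bar>)\<close> on \<open>c\<^sub>0\<close> has constant 1). Cyclic
  shifts are therefore ruled out, and only the translations by \<open>0, \<dots>, D - 1\<close> are used. They replace
  the coordinate at \<open>k\<close> by the mean over the window of length \<open>D\<close> that ends at \<open>k\<close>
  (\<open>norm_sum_ge_window_mean\<close>), where windows that stick out to the left of 0 are short. Such a
  window contains the index 0, whose coordinate \<open>m \<approx> 2 N / 3\<close> is large enough to pay for the missing
  part as long as \<open>D\<close> is at most about \<open>4 N / n\<close>. On the other hand \<open>D = 2 ^ l\<close> needs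
  \<open>(l + 1) / 3 \<ge> (n + 2) / 6\<close>, that is, \<open>l \<ge> n / 2\<close>. The choice \<open>l = \<lceil>n / 2\<rceil>\<close> meets both
  demands (\<open>column_sum_window_ge\<close>).
\<close>

section \<open>Norm estimates for subsymmetric constant 1\<close>

text \<open>The norm is convex along the line in direction \<open>v\<close>, and \<open>s\<close> lies between \<open>-t\<close> and \<open>t\<close>.\<close>

lemma norm_add_scaleR_mono:
  fixes x v :: "'a::real_normed_vector"
  assumes sym: "norm (x - t *\<^sub>R v) \<le> norm (x + t *\<^sub>R v)" and st: "\<bar>s\<bar> \<le> \<bar>t\<bar>"
  shows "norm (x + s *\<^sub>R v) \<le> norm (x + t *\<^sub>R v)"
proof (cases "t = 0")
  case True
  then show ?thesis using st by simp
next
  case False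
  define p where "p = (1 + s / t) / 2"
  have "\<bar>s / t\<bar> \<le> 1" using st False by (simp add: abs_divide)
  then have "-1 \<le> s / t \<and> s / t \<le> 1" by linarith
  then have p: "0 \<le> p" "0 \<le> 1 - p" by (simp_all add: p_def)
  have s: "s = p * t - (1 - p) * t" using False by (simp add: p_def field_simps)
  have "x + s *\<^sub>R v = p *\<^sub>R (x + t *\<^sub>R v) + (1 - p) *\<^sub>R (x - t *\<^sub>R v)"
    unfolding s by (simp add: algebra_simps, simp flip: scaleR_add_left)
  then have "norm (x + s *\<^sub>R v) \<le> p * norm (x + t *\<^sub>R v) + (1 - p) * norm (x - t *\<^sub>R v)"
    using norm_triangle_ineq[of "p *\<^sub>R (x + t *\<^sub>R v)" "(1 - p) *\<^sub>R (x - t *\<^sub>R v)"] p by simp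
  also have "\<dots> \<le> p * norm (x + t *\<^sub>R v) + (1 - p) * norm (x + t *\<^sub>R v)"
    using sym p by (intro add_left_mono mult_left_mono)
  finally show ?thesis by (simp add: algebra_simps)
qed

lemma norm_sum_signed_shift_le:
  fixes \<phi> :: "nat \<Rightarrow> 'a::banach"
  assumes bound: "subsymmetric_bound \<phi> 1" and sgn: "\<And>i. \<theta> i \<in> {-1, 1}"
  shows "norm (\<Sum>i<N. (\<theta> i * a i) *\<^sub>R \<phi> (i + u)) \<le> norm (\<Sum>i<N. a i *\<^sub>R \<phi> i)"
proof -
  define b where "b i = (if i < N then a i else 0)" for i
  have mono: "strict_mono (\<lambda>i. i + u)" by (simp add: strict_mono_def)
  have "(\<lambda>i. b i *\<^sub>R \<phi> i) sums (\<Sum>i<N. b i *\<^sub>R \<phi> i)"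
    by (rule sums_finite) (auto simp: b_def)
  then have r: "summable (\<lambda>i. b i *\<^sub>R \<phi> i)" "(\<Sum>i. b i *\<^sub>R \<phi> i) = (\<Sum>i<N. a i *\<^sub>R \<phi> i)"
    by (auto simp: sums_iff b_def)
  have l: "(\<Sum>i. (\<theta> i * b i) *\<^sub>R \<phi> (i + u)) = (\<Sum>i<N. (\<theta> i * a i) *\<^sub>R \<phi> (i + u))"
    by (subst suminf_finite[of "{..<N}"]) (auto simp: b_def)
  show ?thesis
    using bound[unfolded subsymmetric_bound_def, rule_format, OF r(1) _ mono, of \<theta>] sgn l r(2) by simp
qed

text \<open>Sign changes alone give monotonicity in the moduli of the coordinates: the coordinates are
  replaced one at a time, each replacement being an instance of the convexity lemma.\<close>

lemma norm_sum_mono_abs: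
  fixes \<phi> :: "nat \<Rightarrow> 'a::banach"
  assumes bound: "subsymmetric_bound \<phi> 1" and le: "\<And>i. i < N \<Longrightarrow> \<bar>b i\<bar> \<le> \<bar>a i\<bar>"
  shows "norm (\<Sum>i<N. b i *\<^sub>R \<phi> i) \<le> norm (\<Sum>i<N. a i *\<^sub>R \<phi> i)"
proof -
  \<comment> \<open>\<open>c M\<close>: the coordinates below \<open>M\<close> have been replaced already\<close>
  define c where "c M i = (if i < M then b i else a i)" for M i
  have "norm (\<Sum>i<N. c M i *\<^sub>R \<phi> i) \<le> norm (\<Sum>i<N. a i *\<^sub>R \<phi> i)" if "M \<le> N" for M
    using that
  proof (induction M)
    case 0
    then show ?case by (simp add: c_def)
  next
    case (Suc M)
    define x where "x = (\<Sum>i\<in>{..<N} - {M}. c M i *\<^sub>R \<phi> i)"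
    have M: "M \<in> {..<N}" using Suc.prems by simp
    have 1: "(\<Sum>i<N. c M i *\<^sub>R \<phi> i) = x + a M *\<^sub>R \<phi> M"
      using M by (simp add: x_def sum.remove c_def add.commute)
    have "(\<Sum>i\<in>{..<N} - {M}. c (Suc M) i *\<^sub>R \<phi> i) = x"
      unfolding x_def by (intro sum.cong) (auto simp: c_def less_Suc_eq)
    then have 2: "(\<Sum>i<N. c (Suc M) i *\<^sub>R \<phi> i) = x + b M *\<^sub>R \<phi> M"
      using M by (simp add: sum.remove c_def add.commute)
    define \<theta> where "\<theta> i = (if i = M then -1 else 1 :: real)" for i
    have "(\<Sum>i\<in>{..<N} - {M}. (\<theta> i * c M i) *\<^sub>R \<phi> i) = x"
      unfolding x_def by (intro sum.cong) (auto simp: \<theta>_def)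
    then have 3: "(\<Sum>i<N. (\<theta> i * c M i) *\<^sub>R \<phi> (i + 0)) = x - a M *\<^sub>R \<phi> M"
      using M by (simp add: sum.remove c_def \<theta>_def)
    have "norm (x - a M *\<^sub>R \<phi> M) \<le> norm (x + a M *\<^sub>R \<phi> M)"
      using norm_sum_signed_shift_le[OF bound, where \<theta> = \<theta> and N = N and a = "c M" and u = 0] unfolding 1 3
      by (simp add: \<theta>_def)
    then have "norm (x + b M *\<^sub>R \<phi> M) \<le> norm (x + a M *\<^sub>R \<phi> M)"
      using le M by (intro norm_add_scaleR_mono) auto
    then show ?case using Suc 1 2 by simp
  qed
  from this[of N] show ?thesis by (simp add: c_def)
qed

text \<open>Translating the moduli of the coordinates by \<open>u < D\<close> does not increase the norm; the sum of
  the \<open>D\<close> translates has the window sums as coordinates and is dominated by \<open>D\<close> times the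
  original norm. The windows are one-sided, and shorter near 0, because only translations to the
  right are contractions.\<close>

lemma norm_sum_ge_window_mean:
  fixes \<phi> :: "nat \<Rightarrow> 'a::banach"
  assumes bound: "subsymmetric_bound \<phi> 1" and D: "0 < D" and c: "0 \<le> c"
    and window: "\<And>k. k < N \<Longrightarrow> real D * c \<le> (\<Sum>i | i \<le> k \<and> k < i + D. \<bar>a i\<bar>)"
  shows "c * norm (\<Sum>i<N. \<phi> i) \<le> norm (\<Sum>i<N. a i *\<^sub>R \<phi> i)"
proof -
  \<comment> \<open>the translate by \<open>u\<close>; the indices run to \<open>N + D\<close> because the translates leave \<open>{..<N}\<close>\<close>
  define s where "s u k = (if u \<le> k \<and> k < N + u then \<bar>a (k - u)\<bar> else 0)" for u k
  have shift: "norm (\<Sum>k<N+D. s u k *\<^sub>R \<phi> k) \<le> norm (\<Sum>i<N. a i *\<^sub>R \<phi> i)" if u: "u < D" for u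
  proof -
    define \<theta> where "\<theta> i = (if a i < 0 then -1 else 1 :: real)" for i
    have "(\<Sum>k<N+D. s u k *\<^sub>R \<phi> k) = (\<Sum>k=u..<N+u. s u k *\<^sub>R \<phi> k)"
      using u by (intro sum.mono_neutral_right) (auto simp: s_def)
    also have "\<dots> = (\<Sum>i=0..<N. s u (i + u) *\<^sub>R \<phi> (i + u))"
      using sum.shift_bounds_nat_ivl[of "\<lambda>k. s u k *\<^sub>R \<phi> k" 0 u N] by simp
    also have "\<dots> = (\<Sum>i<N. (\<theta> i * a i) *\<^sub>R \<phi> (i + u))"
      by (intro sum.cong) (auto simp: s_def \<theta>_def)
    finally show ?thesis
      using norm_sum_signed_shift_le[OF bound, where \<theta> = \<theta> and N = N and a = a and u = u] by (simp add: \<theta>_def)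
  qed
  have ge: "real D * c \<le> (\<Sum>u<D. s u k)" if k: "k < N" for k
  proof -
    have "(\<Sum>i | i \<le> k \<and> k < i + D. \<bar>a i\<bar>) = (\<Sum>u | u < D \<and> u \<le> k. \<bar>a (k - u)\<bar>)"
      by (rule sum.reindex_bij_witness[of _ "\<lambda>u. k - u" "\<lambda>i. k - i"]) auto
    also have "\<dots> = (\<Sum>u | u < D \<and> u \<le> k. s u k)"
      using k by (intro sum.cong) (auto simp: s_def)
    also have "\<dots> = (\<Sum>u<D. s u k)"
      by (intro sum.mono_neutral_left) (auto simp: s_def)
    finally show ?thesis using window[OF k] by simp
  qed
  define t where "t k = (if k < N then real D * c else 0)" for k
  have "real D * (c * norm (\<Sum>i<N. \<phi> i)) = norm (\<Sum>i<N. (real D * c) *\<^sub>R \<phi> i)"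
    using c by (simp flip: scaleR_sum_right)
  also have "(\<Sum>i<N. (real D * c) *\<^sub>R \<phi> i) = (\<Sum>k<N+D. t k *\<^sub>R \<phi> k)"
    by (intro sum.mono_neutral_cong_left) (auto simp: t_def)
  also have "norm \<dots> \<le> norm (\<Sum>k<N+D. (\<Sum>u<D. s u k) *\<^sub>R \<phi> k)"
  proof (rule norm_sum_mono_abs[OF bound])
    fix k
    have "0 \<le> (\<Sum>u<D. s u k)" by (intro sum_nonneg) (auto simp: s_def)
    then show "\<bar>t k\<bar> \<le> \<bar>\<Sum>u<D. s u k\<bar>" using ge[of k] c by (auto simp: t_def)
  qed
  also have "(\<Sum>k<N+D. (\<Sum>u<D. s u k) *\<^sub>R \<phi> k) = (\<Sum>u<D. \<Sum>k<N+D. s u k *\<^sub>R \<phi> k)"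
    by (subst sum.swap) (simp add: scaleR_sum_left)
  also have "norm \<dots> \<le> (\<Sum>u<D. norm (\<Sum>i<N. a i *\<^sub>R \<phi> i))"
    by (intro sum_norm_le) (use shift in auto)
  finally show ?thesis using D by simp
qed

section \<open>Column sums of the Sylvester matrices\<close>

text \<open>The conventional value at order 0 fits the recursion, so that inductions can start there.\<close>

lemma sylvester_Suc:
  "sylvester (Suc n) =
     four_block_mat (sylvester n) (sylvester n) (sylvester n) (- sylvester n)"
proof (cases n)
  case 0
  show ?thesis unfolding 0
    by (rule eq_matI) (auto simp: mat_of_rows_list_def numeral_2_eq_2 less_Suc_eq)
qed simp

lemma sylvester_Suc_index:
  assumes "k < 2 ^ n" "i < 2 ^ n"
  shows "sylvester (Suc n) $$ (k, i) = sylvester n $$ (k, i)"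
    and "sylvester (Suc n) $$ (k, 2 ^ n + i) = sylvester n $$ (k, i)"
    and "sylvester (Suc n) $$ (2 ^ n + k, i) = sylvester n $$ (k, i)"
    and "sylvester (Suc n) $$ (2 ^ n + k, 2 ^ n + i) = - sylvester n $$ (k, i)"
  using assms sylvester_carrier[of n] unfolding sylvester_Suc by auto

definition column_sum :: "nat \<Rightarrow> nat \<Rightarrow> nat \<Rightarrow> real" where
  "column_sum n i m = (\<Sum>k<m. sylvester n $$ (k, i))"

lemma column_sum_Suc:
  assumes "m \<le> 2 ^ n" "i < 2 ^ n"
  shows "column_sum (Suc n) i m = column_sum n i m"
    and "column_sum (Suc n) (2 ^ n + i) m = column_sum n i m"
    and "column_sum (Suc n) i (2 ^ n + m) = column_sum n i (2 ^ n) + column_sum n i m"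
    and "column_sum (Suc n) (2 ^ n + i) (2 ^ n + m) = column_sum n i (2 ^ n) - column_sum n i m"
proof -
  have split: "(\<Sum>k<2 ^ n + m. f k) = (\<Sum>k<2 ^ n. f k) + (\<Sum>k<m. f (2 ^ n + k))"
    for f :: "nat \<Rightarrow> real"
    by (induction m) (simp_all add: add.assoc)
  show "column_sum (Suc n) i m = column_sum n i m"
    "column_sum (Suc n) (2 ^ n + i) m = column_sum n i m"
    "column_sum (Suc n) i (2 ^ n + m) = column_sum n i (2 ^ n) + column_sum n i m"
    "column_sum (Suc n) (2 ^ n + i) (2 ^ n + m) = column_sum n i (2 ^ n) - column_sum n i m"
    using assms
    by (simp_all add: column_sum_def split sylvester_Suc_index flip: sum_negf)
qed

lemma le_double_cases:
  fixes m N :: nat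
  assumes "m \<le> 2 * N"
  obtains "m \<le> N" | m' where "m = N + m'" "m' \<le> N"
proof (cases "m \<le> N")
  case False
  then show ?thesis using assms that(2)[of "m - N"] by simp
qed (use that in blast)

lemma column_sum_0: "m \<le> 2 ^ n \<Longrightarrow> column_sum n 0 m = real m"
proof (induction n arbitrary: m)
  case 0
  then show ?case by (cases m) (auto simp: column_sum_def)
next
  case (Suc n)
  from Suc.prems have "m \<le> 2 * 2 ^ n" by simp
  then show ?case
    by (cases rule: le_double_cases) (simp_all add: column_sum_Suc Suc.IH)
qed

text \<open>The column is orthogonal to column 0, which consists of ones.\<close>

lemma column_sum_full:
  assumes "0 < i" "i < 2 ^ n"
  shows "column_sum n i (2 ^ n) = 0"
  using assms
proof (induction n arbitrary: i)
  case (Suc n)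
  have 2: "(2::nat) ^ Suc n = 2 ^ n + 2 ^ n" by simp
  show ?case
  proof (cases "i < 2 ^ n")
    case True
    then show ?thesis unfolding 2 using Suc by (simp add: column_sum_Suc)
  next
    case False
    then obtain j where "i = 2 ^ n + j" "j < 2 ^ n"
      using Suc.prems by (metis 2 add_less_cancel_left le_add_diff_inverse linorder_not_less)
    then show ?thesis unfolding 2 by (simp add: column_sum_Suc)
  qed
qed simp

lemma double_lowbit_dvd_power:
  fixes i :: nat
  assumes "0 < i" "i < 2 ^ n"
  shows "(2 * 2 ^ multiplicity 2 i :: nat) dvd 2 ^ n"
proof -
  have "2 ^ multiplicity 2 i \<le> i"
    using assms by (intro dvd_imp_le multiplicity_dvd)
  then have "(2::nat) ^ multiplicity 2 i < 2 ^ n" using assms by linarith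
  then have "Suc (multiplicity 2 i) \<le> n" by simp
  then have "(2::nat) ^ Suc (multiplicity 2 i) dvd 2 ^ n" by (rule le_imp_power_dvd)
  then show ?thesis by simp
qed

lemma multiplicity_power_add:
  assumes "0 < i" "i < 2 ^ n"
  shows "multiplicity 2 (2 ^ n + i) = multiplicity 2 (i::nat)"
proof -
  obtain q where "(2::nat) ^ n = 2 * 2 ^ multiplicity 2 i * q"
    using double_lowbit_dvd_power[OF assms] by blast
  moreover have "i = 2 ^ multiplicity 2 i * (i div 2 ^ multiplicity 2 i)"
    by (simp add: multiplicity_dvd)
  ultimately have "2 ^ n + i = 2 ^ multiplicity 2 i * (2 * q + i div 2 ^ multiplicity 2 i)"
    by (metis (no_types, lifting) distrib_left mult.assoc mult.commute)
  moreover have "odd (i div 2 ^ multiplicity 2 i)"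
    using assms by (intro multiplicity_decompose) auto
  ultimately show ?thesis
    by (intro multiplicity_eqI) auto
qed

text \<open>The block recursion doubles the rows: column \<open>i\<close> of the lower half repeats the upper half up
  to sign, so by \<open>column_sum_full\<close> the sum starts again from 0 after \<open>2 ^ n\<close> rows, and \<open>2 ^ n\<close> is
  itself a multiple of the period. The new column \<open>2 ^ n\<close> goes up to \<open>2 ^ n\<close> and then down
  to 0. Leaving the multiple \<open>p\<close> unspecified avoids all case distinctions about which one is
  nearest; the choice of \<open>m\<close> below is far from every one of them.\<close>

lemma column_sum_distance:
  assumes "0 < i" "i < 2 ^ n" "m \<le> 2 ^ n"
  shows "\<exists>p::int. \<bar>column_sum n i m\<bar> = \<bar>real m - 2 * 2 ^ multiplicity 2 i * real_of_int p\<bar>"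
  using assms
proof (induction n arbitrary: i m)
  case (Suc n)
  \<comment> \<open>columns \<open>j\<close> and \<open>2 ^ n + j\<close> with \<open>j > 0\<close> have the same period and arise from column \<open>j\<close>\<close>
  have eq: "\<exists>p::int. \<bar>column_sum (Suc n) i m\<bar> = \<bar>real m - 2 * 2 ^ multiplicity 2 i * real_of_int p\<bar>"
    if j: "0 < j" "j < 2 ^ n" and ij: "i = j \<or> i = 2 ^ n + j" and m: "m \<le> 2 * 2 ^ n" for i j m
  proof -
    have mult: "multiplicity 2 i = multiplicity 2 j" using ij j multiplicity_power_add by auto
    from m show ?thesis
    proof (cases rule: le_double_cases)
      case 1
      then have "column_sum (Suc n) i m = column_sum n j m"
        using ij j by (auto simp: column_sum_Suc)
      then show ?thesis using Suc.IH[OF j 1] mult by simp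
    next
      case (2 m')
      then have "\<bar>column_sum (Suc n) i m\<bar> = \<bar>column_sum n j m'\<bar>"
        using ij j by (auto simp: column_sum_Suc column_sum_full)
      moreover obtain p :: int
        where "\<bar>column_sum n j m'\<bar> = \<bar>real m' - 2 * 2 ^ multiplicity 2 j * real_of_int p\<bar>"
        using Suc.IH[OF j 2(2)] by blast
      moreover obtain q where "(2::nat) ^ n = 2 * 2 ^ multiplicity 2 j * q"
        using double_lowbit_dvd_power[OF j] by blast
      then have "(2::real) ^ n = 2 * 2 ^ multiplicity 2 j * real q"
        by (metis of_nat_mult of_nat_numeral of_nat_power)
      then have "real m' - 2 * 2 ^ multiplicity 2 j * real_of_int p
          = real m - 2 * 2 ^ multiplicity 2 i * of_int (p + int q)"
        using 2 mult by (simp add: algebra_simps)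
      ultimately show ?thesis by metis
    qed
  qed
  have m: "m \<le> 2 * 2 ^ n" using Suc.prems by simp
  consider "i < 2 ^ n" | "i = 2 ^ n" | j where "0 < j" "j < 2 ^ n" "i = 2 ^ n + j"
  proof -
    assume *: "i < 2 ^ n \<Longrightarrow> thesis" "i = 2 ^ n \<Longrightarrow> thesis"
      "\<And>j. \<lbrakk>0 < j; j < 2 ^ n; i = 2 ^ n + j\<rbrakk> \<Longrightarrow> thesis"
    show thesis using *(1,2) *(3)[of "i - 2 ^ n"] Suc.prems
      by (cases i "2 ^ n :: nat" rule: linorder_cases) auto
  qed
  then show ?case
  proof cases
    case 1
    then show ?thesis using eq[OF Suc.prems(1) 1 _ m] by blast
  next
    case 3
    then show ?thesis using eq[OF 3(1,2) _ m] by blast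
  next
    case 2
    from m show ?thesis
    proof (cases rule: le_double_cases)
      case 1
      then have "column_sum (Suc n) i m = real m"
        using column_sum_Suc(2)[of m n 0] by (simp add: 2 column_sum_0)
      then show ?thesis by (intro exI[of _ 0]) simp
    next
      case m': (2 m')
      then have "column_sum (Suc n) i m = 2 ^ n - real m'"
        using column_sum_Suc(4)[of m' n 0] by (simp add: 2 column_sum_0)
      moreover have "real m = 2 ^ n + real m'" using m'(1) by simp
      ultimately have "\<bar>column_sum (Suc n) i m\<bar> = \<bar>real m - 2 * 2 ^ n\<bar>" by linarith
      then show ?thesis by (intro exI[of _ 1]) (simp add: 2)
    qed
  qed
qed simp

lemma nearest_two_thirds:
  obtains m :: nat and e :: int where "3 * int m = 2 ^ Suc n + e" "\<bar>e\<bar> = 1"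
proof -
  have "\<exists>m e. 3 * int m = 2 ^ Suc n + e \<and> \<bar>e\<bar> = 1"
  proof (induction n)
    case 0
    show ?case by (intro exI[of _ 1] exI[of _ 1]) simp
  next
    case (Suc n)
    then obtain m e where e: "3 * int m = 2 ^ Suc n + e" "\<bar>e\<bar> = 1" by blast
    have "(1::int) \<le> 2 ^ n" by simp
    then have "0 \<le> 2 * int m - e" using e unfolding power_Suc by linarith
    then have "3 * int (nat (2 * int m - e)) = 2 ^ Suc (Suc n) + - e"
      using e by simp
    then show ?case using e by (intro exI[of _ "nat (2 * int m - e)"] exI[of _ "-e"]) auto
  qed
  then show ?thesis using that by blast
qed

text \<open>Let \<open>g\<close> be the period. Then \<open>3 (m - p g) - e\<close> is a multiple of \<open>g\<close>, and it is not 0 because the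
  cofactor is a power of 2 minus a multiple of 3.\<close>

lemma abs_column_sum_ge:
  assumes i: "0 < i" "i < 2 ^ n" and m: "m \<le> 2 ^ n"
    and e: "3 * int m = 2 ^ Suc n + e" "\<bar>e\<bar> = 1"
  shows "(2 * 2 ^ multiplicity 2 i - 1) / 3 \<le> \<bar>column_sum n i m\<bar>"
proof -
  define g :: int where "g = 2 * 2 ^ multiplicity 2 i"
  obtain p :: int where p: "\<bar>column_sum n i m\<bar> = \<bar>real m - 2 * 2 ^ multiplicity 2 i * real_of_int p\<bar>"
    using column_sum_distance[OF i m] by blast
  also have "\<dots> = real_of_int \<bar>int m - g * p\<bar>" by (simp add: g_def)
  finally have col: "\<bar>column_sum n i m\<bar> = real_of_int \<bar>int m - g * p\<bar>" .
  obtain q where "(2::nat) ^ n = 2 * 2 ^ multiplicity 2 i * q"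
    using double_lowbit_dvd_power[OF i] by blast
  then have q: "(2::int) ^ n = g * int q"
    unfolding g_def by (metis of_nat_mult of_nat_numeral of_nat_power)
  have "\<not> 3 dvd (2::int) ^ Suc n"
    using prime_dvd_power[of "3::int" 2 "Suc n"] by auto
  then have "2 * int q - 3 * p \<noteq> 0"
    using q by (metis dvd_mult dvd_triv_left eq_iff_diff_eq_0 mult.left_commute power_Suc)
  then have "g \<le> g * \<bar>2 * int q - 3 * p\<bar>"
    by (simp add: g_def)
  also have "\<dots> = \<bar>g * (2 * int q - 3 * p)\<bar>" by (simp add: g_def abs_mult)
  also have "\<dots> = \<bar>3 * (int m - g * p) - e\<bar>"
    by (rule arg_cong[of _ _ abs]) (use e(1) q in \<open>simp add: algebra_simps\<close>)
  also have "\<bar>3 * x - e\<bar> \<le> 3 * \<bar>x\<bar> + 1" for x using e(2) by linarith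
  finally have "real_of_int g \<le> 3 * \<bar>column_sum n i m\<bar> + 1" unfolding col by linarith
  then show ?thesis by (simp add: g_def)
qed

lemma sum_lessThan_double:
  fixes f :: "nat \<Rightarrow> nat"
  shows "(\<Sum>i<2 * M. f i) = (\<Sum>j<M. f (2 * j) + f (Suc (2 * j)))"
  by (induction M) simp_all

text \<open>In a window of even length every second number is odd and contributes 1, and the halves of the
  even ones form a window of half the length.\<close>

lemma sum_lowbit_window_ge:
  fixes a :: nat
  assumes "0 < a"
  shows "2 ^ l * (l + 2) \<le> 2 * (\<Sum>i<2 ^ l. 2 ^ multiplicity 2 (a + i) :: nat)"
  using assms
proof (induction l arbitrary: a)
  case (Suc l)
  have even: "(2::nat) ^ multiplicity 2 (2 * b) = 2 * 2 ^ multiplicity 2 b" if "0 < b" for b :: nat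
    using that by (simp add: multiplicity_times_same)
  have odd: "(2::nat) ^ multiplicity 2 (Suc (2 * b)) = 1" for b :: nat
    by (simp add: not_dvd_imp_multiplicity_0)
  obtain b :: nat where b: "0 < b"
    and "(\<Sum>i<2 ^ Suc l. 2 ^ multiplicity 2 (a + i) :: nat)
           = (\<Sum>j<2 ^ l. 1 + 2 * 2 ^ multiplicity 2 (b + j))"
  proof (cases "even a")
    case True
    then obtain b where a: "a = 2 * b" by blast
    then have "0 < b" using Suc.prems by simp
    moreover from this have "2 ^ multiplicity 2 (a + 2 * j) = 2 * (2::nat) ^ multiplicity 2 (b + j)"
      "2 ^ multiplicity 2 (a + Suc (2 * j)) = (1::nat)" for j
      using even[of "b + j"] odd[of "b + j"] by (simp_all add: a)
    ultimately show ?thesis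
      using that[of b] by (simp add: sum_lessThan_double)
  next
    case False
    then obtain b where a: "a = Suc (2 * b)" by (metis oddE Suc_eq_plus1)
    have "2 ^ multiplicity 2 (a + 2 * j) = (1::nat)"
      "2 ^ multiplicity 2 (a + Suc (2 * j)) = 2 * (2::nat) ^ multiplicity 2 (Suc b + j)" for j
      using odd[of "b + j"] even[of "Suc b + j"] by (simp_all add: a)
    then show ?thesis
      using that[of "Suc b"] by (simp add: sum_lessThan_double)
  qed
  then show ?case
    using Suc.IH[OF b] by (simp add: sum_Suc sum_distrib_left[symmetric] algebra_simps)
next
  case 0
  have "(1::nat) \<le> 2 ^ multiplicity 2 a" by simp
  moreover have "(\<Sum>i<2 ^ 0. 2 ^ multiplicity 2 (a + i) :: nat) = 2 ^ multiplicity 2 a" by simp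
  moreover have "2 ^ 0 * (0 + 2) = (2::nat)" by simp
  ultimately show ?case by linarith
qed

section \<open>The lower bound for the Sylvester matrices\<close>

text \<open>The window length \<open>2 ^ l\<close> has to be long enough for full windows to have a mean of
  \<open>(l + 1) / 3 \<ge> (n + 2) / 6\<close>, and short enough for the single coordinate \<open>m\<close> at 0 to suffice for
  the truncated ones. For \<open>n = 1\<close> the second condition holds with equality.\<close>

lemma column_sum_window_ge:
  assumes n: "1 \<le> n" and m: "m \<le> 2 ^ n"
    and e: "3 * int m = 2 ^ Suc n + e" "\<bar>e\<bar> = 1"
    and l: "l = (n + 1) div 2" and k: "k < 2 ^ n"
  shows "2 ^ l * ((real n + 2) / 6) \<le> (\<Sum>i | i \<le> k \<and> k < i + 2 ^ l. \<bar>column_sum n i m\<bar>)"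
proof (cases "k < 2 ^ l")
  case True
  \<comment> \<open>the window contains index 0, and \<open>6 m \<ge> 2 (2 ^ (n + 1) - 1)\<close>\<close>
  have "(2::nat) ^ l * (n + 2) + 2 \<le> 2 * 2 ^ Suc n"
  proof -
    have h: "l + 1 \<le> 2 ^ l" by (induction l) auto
    have "1 \<le> l" "n + 1 = 2 * l \<or> n = 2 * l" using n l by auto
    then have "2 \<le> (2::nat) ^ l" using power_increasing[of 1 l "2::nat"] by simp
    show ?thesis
      using \<open>n + 1 = 2 * l \<or> n = 2 * l\<close>
    proof
      assume "n + 1 = 2 * l"
      then have "(2::nat) ^ Suc n = 2 ^ l * 2 ^ l"
        by (metis Suc_eq_plus1 mult_2 power_add)
      moreover have "(2::nat) ^ l * (2 * (l + 1)) \<le> 2 ^ l * (2 * 2 ^ l)"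
        using h by (intro mult_left_mono) auto
      moreover have "n + 3 = 2 * (l + 1)" using \<open>n + 1 = 2 * l\<close> by simp
      then have "(2::nat) ^ l * (n + 3) = 2 ^ l * (2 * (l + 1))" by metis
      ultimately show ?thesis using \<open>2 \<le> 2 ^ l\<close> by (simp add: algebra_simps)
    next
      assume n2: "n = 2 * l"
      then have "(2::nat) ^ Suc n = 2 * (2 ^ l * 2 ^ l)"
        by (simp add: mult_2 power_add)
      moreover have "(2::nat) ^ l * (2 * (l + 1)) \<le> 2 ^ l * (2 * 2 ^ l)"
        using h by (intro mult_left_mono) auto
      moreover have "2 * 2 \<le> 2 ^ l * (2::nat) ^ l"
        using \<open>2 \<le> 2 ^ l\<close> by (intro mult_mono) auto
      ultimately show ?thesis using n2 by (simp add: algebra_simps)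
    qed
  qed
  then have "int (2 ^ l * (n + 2)) \<le> 2 * (3 * int m)"
    using e by (simp add: zle_int[symmetric] del: power_Suc)
  then have "2 ^ l * (n + 2) \<le> 6 * m" by linarith
  then have "real (2 ^ l * (n + 2)) \<le> real (6 * m)" by (rule of_nat_mono)
  then have "2 ^ l * ((real n + 2) / 6) \<le> \<bar>column_sum n 0 m\<bar>"
    using m by (simp add: column_sum_0 algebra_simps)
  also have "\<dots> \<le> (\<Sum>i | i \<le> k \<and> k < i + 2 ^ l. \<bar>column_sum n i m\<bar>)"
    using True by (intro member_le_sum) auto
  finally show ?thesis .
next
  case False
  \<comment> \<open>the window is full and consists of positive indices, the first of which is \<open>a\<close>\<close>
  define a where "a = Suc k - 2 ^ l"
  have a: "0 < a" "Suc k = a + 2 ^ l" using False by (auto simp: a_def)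
  define S :: nat where "S = (\<Sum>i<2 ^ l. 2 ^ multiplicity 2 (a + i))"
  have "n \<le> 2 * l" using l by simp
  then have "2 ^ l * real n \<le> 2 ^ l * real (2 * l)" by (intro mult_left_mono of_nat_mono) auto
  then have "2 ^ l * real n \<le> 2 * (2 ^ l * real l)" by (simp only: of_nat_mult of_nat_numeral mult.left_commute)
  moreover have "real (2 ^ l * (l + 2)) \<le> real (2 * S)"
    unfolding S_def by (intro of_nat_mono sum_lowbit_window_ge a)
  then have "2 ^ l * real l + 2 * 2 ^ l \<le> 2 * real S" by (simp add: algebra_simps)
  moreover have "(x + 2 * z) / 6 \<le> (2 * w - z) / 3" if "x \<le> 2 * y" "y + 2 * z \<le> 2 * w"
    for w x y z :: real
    using that by simp
  ultimately have "(2 ^ l * real n + 2 * 2 ^ l) / 6 \<le> (2 * real S - 2 ^ l) / 3" by blast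
  then have "2 ^ l * ((real n + 2) / 6) \<le> (2 * real S - 2 ^ l) / 3" by (simp add: algebra_simps)
  also have "\<dots> = (\<Sum>i<2 ^ l. (2 * 2 ^ multiplicity 2 (a + i) - 1) / 3)"
    by (simp add: S_def sum_subtractf sum_distrib_left[symmetric] sum_divide_distrib[symmetric])
  also have "\<dots> \<le> (\<Sum>i<2 ^ l. \<bar>column_sum n (a + i) m\<bar>)"
    using a k by (intro sum_mono abs_column_sum_ge[OF _ _ m e]) auto
  also have "\<dots> = (\<Sum>i | i \<le> k \<and> k < i + 2 ^ l. \<bar>column_sum n i m\<bar>)"
    using a by (intro sum.reindex_bij_witness[of _ "\<lambda>i. i - a" "\<lambda>i. a + i"]) auto
  finally show ?thesis .
qed

theorem theorem3p6:
  fixes \<phi> :: "nat \<Rightarrow> 'a::banach" and n :: nat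
  assumes "normalized \<phi>"
    and "subsymmetric_basis \<phi>"
    and "is_subsymmetric_constant \<phi> 1"
    and "n \<ge> 1"
  shows "sylvester_rho \<phi> n \<ge> max ((real n + 2) / 6 * fundamental_fun \<phi> (2 ^ n)) (2 ^ n)"
proof -
  have bound: "subsymmetric_bound \<phi> 1"
    using assms(3) by (simp add: is_subsymmetric_constant_def)
  have rho: "norm (\<Sum>i<2 ^ n. column_sum n i m *\<^sub>R \<phi> i) \<le> sylvester_rho \<phi> n"
    if "1 \<le> m" "m \<le> 2 ^ n" for m
    unfolding sylvester_rho_def column_sum_def using that by (intro Max_ge) auto
  obtain m e where e: "3 * int m = 2 ^ Suc n + e" "\<bar>e\<bar> = 1" by (rule nearest_two_thirds)
  have "2 \<le> (2::int) ^ n" using power_increasing[of 1 n "2::int"] assms(4) by simp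
  then have "1 \<le> int m \<and> int m \<le> 2 ^ n" using e unfolding power_Suc by linarith
  then have m: "1 \<le> m" "m \<le> 2 ^ n" by auto
  have "(real n + 2) / 6 * fundamental_fun \<phi> (2 ^ n)
      \<le> norm (\<Sum>i<2 ^ n. column_sum n i m *\<^sub>R \<phi> i)"
    unfolding fundamental_fun_def
    using column_sum_window_ge[OF assms(4) m(2) e refl]
    by (intro norm_sum_ge_window_mean[OF bound, of "2 ^ ((n + 1) div 2)"]) simp_all
  also have "\<dots> \<le> sylvester_rho \<phi> n" by (rule rho[OF m])
  finally have 1: "(real n + 2) / 6 * fundamental_fun \<phi> (2 ^ n) \<le> sylvester_rho \<phi> n" .
  define b where "b i = (if i = 0 then 2 ^ n else 0 :: real)" for i :: nat
  have "(\<Sum>i<2 ^ n. b i *\<^sub>R \<phi> i) = (\<Sum>i\<in>{0}. b i *\<^sub>R \<phi> i)"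
    by (intro sum.mono_neutral_right) (auto simp: b_def)
  then have "2 ^ n = norm (\<Sum>i<2 ^ n. b i *\<^sub>R \<phi> i)"
    using assms(1) by (simp add: b_def normalized_def)
  also have "\<dots> \<le> norm (\<Sum>i<2 ^ n. column_sum n i (2 ^ n) *\<^sub>R \<phi> i)"
    by (intro norm_sum_mono_abs[OF bound]) (auto simp: b_def column_sum_0)
  also have "\<dots> \<le> sylvester_rho \<phi> n" by (rule rho) auto
  finally show ?thesis using 1 by simp
qed

end
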